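(* Let $S$ be a subfit and round $\vee$-semilattice. Then for any $p,q\in S$, $$p\leq q\quad\Leftrightarrow\quad\widehat{S}_p\subseteq\widehat{S}_q.$$
   Context: A $\vee$-semilattice is a non-empty poset in which any two elements $p,q$ have a supremum $p\vee q$. A grill in a $\vee$-semilattice $S$ is a subset $G\subseteq S$ such that $p\vee q\geq g\in G$ implies $p\in G$ or $q\in G$. The spectrum $\widehat{S}$ is the set of all proper minimal non-empty grills of $S$, i.e. grills $G$ with $\emptyset\neq G\neq S$ such that no non-empty grill is strictly contained in $G$; and $\widehat{S}_p=\{G\in\widehat{S}:p\in G\}$. A non-empty finite $F\subseteq S$ is far if for all $p,q\in S$: if $p\leq q\vee f$ for all $f\in F$, then $p\leq q$. The rather below relation is defined by: $p\prec q$ iff for all $s\in S$ with $s\nleq q$ there is a finite $F\subseteq S$ such that $F\cup\{p\}$ is far and $s\leq f\vee q$ for all $f\in F$. $S$ is round if for every $p\in S$ there is $q\in S$ with $p\prec q$. $S$ is subfit if for all $p,q\in S$: $p\nleq q$ iff for every $p'\geq p$ there is $q'\geq q$ with $p\vee q'\geq p'$ and $p'\nleq q'$. *)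

theory Defs
  imports Main
begin

text \<open>A \<open>\<or>\<close>-semilattice \<open>S\<close> is a type of class \<^class>\<open>semilattice_sup\<close>, so that
  \<open>S\<close> itself is \<^term>\<open>UNIV\<close>; non-emptiness is automatic.\<close>

definition grill :: "'a::semilattice_sup set \<Rightarrow> bool" where
  "grill G \<longleftrightarrow> (\<forall>p q. \<forall>g\<in>G. g \<le> sup p q \<longrightarrow> p \<in> G \<or> q \<in> G)"

definition spectrum :: "'a::semilattice_sup set set" where
  "spectrum = {G. grill G \<and> G \<noteq> {} \<and> G \<noteq> UNIV \<and> \<not> (\<exists>H. grill H \<and> H \<noteq> {} \<and> H \<subset> G)}"

definition spectrum_at :: "'a::semilattice_sup \<Rightarrow> 'a set set" where
  "spectrum_at p = {G \<in> spectrum. p \<in> G}"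

definition far :: "'a::semilattice_sup set \<Rightarrow> bool" where
  "far F \<longleftrightarrow> F \<noteq> {} \<and> finite F \<and> (\<forall>p q. (\<forall>f\<in>F. p \<le> sup q f) \<longrightarrow> p \<le> q)"

text \<open>The set \<open>F\<close> below may be empty; only \<^term>\<open>F \<union> {p}\<close> has to be far.\<close>

definition rather_below :: "'a::semilattice_sup \<Rightarrow> 'a \<Rightarrow> bool" (infix "\<prec>" 50) where
  "p \<prec> q \<longleftrightarrow> (\<forall>s. \<not> s \<le> q \<longrightarrow>
     (\<exists>F. finite F \<and> far (F \<union> {p}) \<and> (\<forall>f\<in>F. s \<le> sup f q)))"

definition round_semilattice :: "'a::semilattice_sup itself \<Rightarrow> bool" where
  "round_semilattice _ \<longleftrightarrow> (\<forall>p::'a. \<exists>q. p \<prec> q)"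

definition subfit_semilattice :: "'a::semilattice_sup itself \<Rightarrow> bool" where
  "subfit_semilattice _ \<longleftrightarrow> (\<forall>p q::'a. \<not> p \<le> q \<longleftrightarrow>
     (\<forall>p'\<ge>p. \<exists>q'\<ge>q. p' \<le> sup p q' \<and> \<not> p' \<le> q'))"

end

theory Submission
  imports Defs
begin

text \<open>
  Complements of grills are ideals, so the spectrum consists of the complements of the maximal
  proper non-empty ideals. Given \<open>p \<nleq> q\<close>, roundness yields \<open>p \<prec> r\<close>, and subfitness applied to
  \<open>r \<ge> p\<close> yields \<open>q' \<ge> q\<close> with \<open>r \<le> p \<or> q'\<close> and \<open>r \<nleq> q'\<close>. By Zorn's lemma there is an ideal \<open>M\<close>
  that is maximal among those containing \<open>q'\<close> but not \<open>r\<close>; it cannot contain \<open>p\<close>. The relation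
  \<open>p \<prec> r\<close> makes \<open>M\<close> maximal among all proper ideals, so its complement contains \<open>p\<close> but not \<open>q\<close>.
\<close>

text \<open>The empty set counts as an ideal, so that complementation also covers the grill
  \<open>UNIV\<close>.\<close>

definition join_ideal :: "'a::semilattice_sup set \<Rightarrow> bool" where
  "join_ideal I \<longleftrightarrow> (\<forall>x y. y \<in> I \<longrightarrow> x \<le> y \<longrightarrow> x \<in> I) \<and> (\<forall>x\<in>I. \<forall>y\<in>I. sup x y \<in> I)"

lemma join_ideal_downD: "join_ideal I \<Longrightarrow> y \<in> I \<Longrightarrow> x \<le> y \<Longrightarrow> x \<in> I"
  unfolding join_ideal_def by blast

lemma join_ideal_supD: "join_ideal I \<Longrightarrow> x \<in> I \<Longrightarrow> y \<in> I \<Longrightarrow> sup x y \<in> I"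
  unfolding join_ideal_def by blast

lemma grill_upD: "grill G \<Longrightarrow> x \<in> G \<Longrightarrow> x \<le> y \<Longrightarrow> y \<in> G"
  unfolding grill_def by (metis sup.idem)

lemma grill_iff_join_ideal: "grill G \<longleftrightarrow> join_ideal (- G)"
proof
  assume G: "grill G"
  then have "x \<notin> G" if "y \<notin> G" "x \<le> y" for x y
    using that grill_upD by blast
  moreover have "sup x y \<notin> G" if "x \<notin> G" "y \<notin> G" for x y
    using G that unfolding grill_def by blast
  ultimately show "join_ideal (- G)"
    unfolding join_ideal_def by blast
next
  assume "join_ideal (- G)"
  then show "grill G"
    unfolding grill_def using join_ideal_downD join_ideal_supD by blast
qed

lemma le_sup_trans:
  fixes s x m n :: "'a::semilattice_sup"
  shows "s \<le> sup x m \<Longrightarrow> m \<le> n \<Longrightarrow> s \<le> sup x n"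
  using order_trans sup_mono[OF order_refl] by blast

lemma join_ideal_atMost: "join_ideal {..a}"
  unfolding join_ideal_def by auto

lemma join_ideal_Union_chain:
  assumes "subset.chain {I. join_ideal I} C"
  shows "join_ideal (\<Union>C)"
proof -
  have ideals: "join_ideal I" if "I \<in> C" for I
    using assms that unfolding subset.chain_def by blast
  have "sup x y \<in> \<Union>C" if "x \<in> I" "I \<in> C" "y \<in> J" "J \<in> C" for x y I J
  proof -
    have "I \<subseteq> J \<or> J \<subseteq> I"
      using assms that unfolding subset_chain_def by blast
    then show ?thesis
      using that join_ideal_supD ideals by blast
  qed
  moreover have "x \<in> \<Union>C" if "y \<in> \<Union>C" "x \<le> y" for x y
    using that ideals join_ideal_downD by blast
  ultimately show ?thesis
    unfolding join_ideal_def by blast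
qed

text \<open>For non-empty \<open>M\<close> this is the ideal generated by \<open>M\<close> and
  \<open>x\<close>; two witnesses \<open>m\<close>, \<open>n\<close> are replaced by their
  join.\<close>

lemma join_ideal_adjoin:
  assumes "join_ideal M"
  shows "join_ideal {s. \<exists>m\<in>M. s \<le> sup x m}"
  unfolding join_ideal_def
proof (intro conjI allI impI ballI)
  fix s t assume "t \<in> {s. \<exists>m\<in>M. s \<le> sup x m}" "s \<le> t"
  then show "s \<in> {s. \<exists>m\<in>M. s \<le> sup x m}"
    using order_trans by blast
next
  fix s t
  assume "s \<in> {s. \<exists>m\<in>M. s \<le> sup x m}" "t \<in> {s. \<exists>m\<in>M. s \<le> sup x m}"
  then obtain m n where "m \<in> M" "n \<in> M" "s \<le> sup x m" "t \<le> sup x n"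
    by blast
  then have "sup m n \<in> M" "sup s t \<le> sup x (sup m n)"
    using join_ideal_supD[OF assms] le_sup_trans sup_ge1 sup_ge2 by (blast, metis sup_least)
  then show "sup s t \<in> {s. \<exists>m\<in>M. s \<le> sup x m}"
    by blast
qed

text \<open>Zorn's lemma, started at the principal ideal of \<open>a\<close>. The last property is
  maximality in elementwise form: adjoining any outside \<open>x\<close> to \<open>M\<close>
  captures \<open>r\<close>.\<close>

lemma exists_maximal_join_ideal_avoiding:
  assumes "\<not> r \<le> a"
  obtains M where "join_ideal M" "a \<in> M" "r \<notin> M"
    and "\<And>x. x \<notin> M \<Longrightarrow> \<exists>m\<in>M. r \<le> sup x m"
proof -
  define A where "A = {I. join_ideal I \<and> a \<in> I \<and> r \<notin> I}"
  have "\<exists>M\<in>A. \<forall>X\<in>A. M \<subseteq> X \<longrightarrow> X = M"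
  proof (rule subset_Zorn_nonempty)
    show "A \<noteq> {}"
      using assms join_ideal_atMost[of a] unfolding A_def by auto
    show "\<Union>C \<in> A" if "C \<noteq> {}" "subset.chain A C" for C
    proof -
      have "subset.chain {I. join_ideal I} C" "C \<subseteq> A"
        using that unfolding subset_chain_def A_def by blast+
      then show ?thesis
        using that(1) join_ideal_Union_chain unfolding A_def by blast
    qed
  qed
  then obtain M where M: "join_ideal M" "a \<in> M" "r \<notin> M"
    and max: "\<And>X. X \<in> A \<Longrightarrow> M \<subseteq> X \<Longrightarrow> X = M"
    unfolding A_def by blast
  have "\<exists>m\<in>M. r \<le> sup x m" if "x \<notin> M" for x
  proof (rule ccontr)
    let ?X = "{s. \<exists>m\<in>M. s \<le> sup x m}"
    assume "\<not> ?thesis"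
    \<comment> \<open>If \<open>r\<close> is not captured, \<open>?X\<close> is a member of
      \<open>A\<close> above \<open>M\<close> that contains the new element
      \<open>x\<close>.\<close>
    moreover have "M \<subseteq> ?X" "x \<in> ?X"
      using M(2) sup_ge1 sup_ge2 by blast+
    ultimately have "?X \<in> A"
      using M join_ideal_adjoin unfolding A_def by blast
    then have "?X = M"
      using max \<open>M \<subseteq> ?X\<close> by blast
    then show False
      using \<open>x \<in> ?X\<close> that by blast
  qed
  with M show thesis
    using that by blast
qed

text \<open>Joining the finitely many witnesses gives a common one; starting from \<open>a\<close>
  handles empty \<open>F\<close> and keeps the witness above \<open>a\<close>.\<close>

lemma join_ideal_finite_witness:
  assumes "join_ideal M" "a \<in> M" "finite F" "\<And>f. f \<in> F \<Longrightarrow> \<exists>m\<in>M. r \<le> sup f m"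
  shows "\<exists>m\<in>M. a \<le> m \<and> (\<forall>f\<in>F. r \<le> sup f m)"
  using assms(3,4)
proof (induction F)
  case empty
  then show ?case
    using assms(2) by blast
next
  case (insert f F)
  then obtain m n where "m \<in> M" "a \<le> m" "\<forall>f\<in>F. r \<le> sup f m" "n \<in> M" "r \<le> sup f n"
    by blast
  then have "sup m n \<in> M" "a \<le> sup m n" "\<forall>g\<in>insert f F. r \<le> sup g (sup m n)"
    using join_ideal_supD[OF assms(1)] by (auto intro: le_supI1 le_sup_trans)
  then show ?case
    by blast
qed

text \<open>Otherwise taking \<open>s = p\<close> in the definition gives \<open>F\<close> with p
  \<le> f \<or> r for all \<open>f\<close> in \<open>F\<close>. The same bound holds trivially for
  \<open>p\<close> itself, so farness of \<open>F \<union> {p}\<close> forces p \<le> r.\<close>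

lemma rather_below_imp_le:
  assumes "p \<prec> r"
  shows "p \<le> r"
proof (rule ccontr)
  assume "\<not> p \<le> r"
  then obtain F where "far (F \<union> {p})" "\<forall>f\<in>F. p \<le> sup f r"
    using assms unfolding rather_below_def by blast
  then have "p \<le> r"
    unfolding far_def by (auto simp: sup_commute)
  with \<open>\<not> p \<le> r\<close> show False ..
qed

text \<open>Upgrades maximality among ideals avoiding \<open>r\<close> to maximality among all
  proper ideals: \<open>M\<close> together with \<open>x\<close> generates every \<open>s\<close>,
  not only \<open>r\<close>.\<close>

lemma rather_below_maximal_join_ideal:
  assumes "p \<prec> r" "join_ideal M" "a \<in> M" "r \<notin> M" "r \<le> sup p a"
    and max: "\<And>x. x \<notin> M \<Longrightarrow> \<exists>m\<in>M. r \<le> sup x m"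
    and "x \<notin> M"
  shows "\<exists>m\<in>M. s \<le> sup x m"
proof -
  obtain n where n: "n \<in> M" "r \<le> sup x n"
    using max[OF \<open>x \<notin> M\<close>] by blast
  show ?thesis
  proof (cases "s \<le> r")
    case True
    then show ?thesis
      using n order_trans by blast
  next
    case False
    then obtain F where F: "finite F" "far (F \<union> {p})" "\<forall>f\<in>F. s \<le> sup f r"
      using assms(1) unfolding rather_below_def by blast
    \<comment> \<open>If \<open>F\<close> missed \<open>M\<close>, a single \<open>m\<close> in
      \<open>M\<close> would satisfy r \<le> f \<or> m for all \<open>f\<close> in \<open>F\<close>,
      and also for \<open>p\<close> because m \<ge> a. Farness would then give r \<le> m, putting
      \<open>r\<close> into \<open>M\<close>.\<close>
    have "\<exists>f\<in>F. f \<in> M"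
    proof (rule ccontr)
      assume "\<not> ?thesis"
      then obtain m where m: "m \<in> M" "a \<le> m" "\<forall>f\<in>F. r \<le> sup f m"
        using join_ideal_finite_witness[OF assms(2,3) F(1)] max by metis
      moreover have "r \<le> sup p m"
        using assms(5) m(2) by (rule le_sup_trans)
      ultimately have "\<forall>f\<in>F \<union> {p}. r \<le> sup m f"
        by (auto simp: sup_commute)
      then have "r \<le> m"
        using F(2) unfolding far_def by blast
      then show False
        using assms(2,4) m(1) join_ideal_downD by blast
    qed
    then obtain f where f: "f \<in> F" "f \<in> M"
      by blast
    have "s \<le> sup f r"
      using F(3) f(1) by blast
    also have "\<dots> \<le> sup f (sup x n)"
      using n(2) by (rule sup_mono[OF order_refl])
    also have "\<dots> = sup x (sup f n)"
      by (rule sup_left_commute)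
    finally show ?thesis
      using join_ideal_supD[OF assms(2) f(2) n(1)] by blast
  qed
qed

text \<open>A smaller non-empty grill \<open>H\<close> omits some \<open>x\<close> outside
  \<open>M\<close>. Any \<open>s\<close> in \<open>H\<close> lies below x \<or> m with
  \<open>m\<close> in \<open>M\<close>, so the grill property forces \<open>m\<close> into
  \<open>H\<close>, which is disjoint from \<open>M\<close>.\<close>

lemma Compl_maximal_join_ideal_in_spectrum:
  assumes "join_ideal M" "M \<noteq> {}" "M \<noteq> UNIV"
    and max: "\<And>x s. x \<notin> M \<Longrightarrow> \<exists>m\<in>M. s \<le> sup x m"
  shows "- M \<in> spectrum"
proof -
  have "\<not> H \<subset> - M" if "grill H" "H \<noteq> {}" for H
  proof
    assume "H \<subset> - M"
    then obtain x where x: "x \<notin> M" "x \<notin> H"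
      by blast
    obtain s where "s \<in> H"
      using \<open>H \<noteq> {}\<close> by blast
    then obtain m where "m \<in> M" "s \<le> sup x m"
      using max[OF x(1)] by blast
    then have "m \<in> H"
      using \<open>grill H\<close> \<open>s \<in> H\<close> x(2) unfolding grill_def by blast
    with \<open>m \<in> M\<close> \<open>H \<subset> - M\<close> show False
      by blast
  qed
  with assms(1-3) show ?thesis
    unfolding spectrum_def by (auto simp: grill_iff_join_ideal)
qed

lemma spectrum_at_mono: "p \<le> q \<Longrightarrow> spectrum_at p \<subseteq> spectrum_at q"
  unfolding spectrum_at_def spectrum_def using grill_upD by blast

theorem proposition7p4:
  fixes p q :: "'a::semilattice_sup"
  assumes "subfit_semilattice TYPE('a)"
    and "round_semilattice TYPE('a)"
  shows "p \<le> q \<longleftrightarrow> spectrum_at p \<subseteq> spectrum_at q"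
proof
  show "spectrum_at p \<subseteq> spectrum_at q" if "p \<le> q"
    using that by (rule spectrum_at_mono)
next
  assume sub: "spectrum_at p \<subseteq> spectrum_at q"
  show "p \<le> q"
  proof (rule ccontr)
    assume "\<not> p \<le> q"
    obtain r where r: "p \<prec> r"
      using assms(2) unfolding round_semilattice_def by blast
    \<comment> \<open>Subfitness with p' = r, admissible since p \<le> r; \<open>a\<close> is the
      resulting q'.\<close>
    then obtain a where a: "q \<le> a" "r \<le> sup p a" "\<not> r \<le> a"
      using assms(1) \<open>\<not> p \<le> q\<close> rather_below_imp_le unfolding subfit_semilattice_def by blast
    obtain M where M: "join_ideal M" "a \<in> M" "r \<notin> M"
      and max: "\<And>x. x \<notin> M \<Longrightarrow> \<exists>m\<in>M. r \<le> sup x m"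
      using exists_maximal_join_ideal_avoiding[OF a(3)] by blast
    \<comment> \<open>Otherwise p \<or> a, and with it \<open>r\<close>, would lie in
      \<open>M\<close>.\<close>
    have "p \<notin> M"
      using M a(2) join_ideal_downD join_ideal_supD by blast
    moreover have "q \<in> M"
      using M a(1) join_ideal_downD by blast
    moreover have "- M \<in> spectrum"
      using Compl_maximal_join_ideal_in_spectrum[OF M(1)]
        rather_below_maximal_join_ideal[OF r M a(2) max] M by blast
    ultimately show False
      using sub unfolding spectrum_at_def by blast
  qed
qed

end
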